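(* Let $(L,[-,-],\alpha)$ be a Hom-Lie algebra over $\mathbf{k}$ and let $f \colon L \to L$ be a linear map such that $f\alpha = \alpha f$. Define the products $$x \star y = [f(x),y], \qquad x \star' y = [x,f(y)]$$ for $x,y \in L$. Then: (1) $(L,\star,\alpha)$ is a Hom-Novikov algebra if and only if the following two conditions hold for all $x,y,z \in L$: $$f([f(x),y] + [x,f(y)]) - [f(x),f(y)] \in Z(\alpha(L))$$ and $$[f([f(x),y]),\alpha(z)] = [f([f(x),z]),\alpha(y)].$$ (2) $(L,\star',\alpha)$ is a Hom-Novikov algebra if and only if the following two conditions hold for all $x,y,z \in L$: $$[[x,f(y)] + [f(x),y], f(\alpha(z))] - [\alpha(x),f([y,f(z)])] + [\alpha(y),f([x,f(z)])] = 0$$ and $$[f(x),f(y)] \in Z(\alpha(L)).$$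
   Context: Throughout, $\mathbf{k}$ is a ground field of characteristic $0$; vector spaces and (bi)linear maps are over $\mathbf{k}$. A Hom-Lie algebra is a triple $(L,[-,-],\alpha)$ consisting of a vector space $L$, a linear map $\alpha \colon L \to L$, and a bilinear, skew-symmetric bracket $[-,-] \colon L^{\otimes 2} \to L$ such that for all $x,y,z \in L$: $\alpha[x,y] = [\alpha(x),\alpha(y)]$ (multiplicativity) and $[[x,y],\alpha(z)] + [[z,x],\alpha(y)] + [[y,z],\alpha(x)] = 0$ (Hom-Jacobi identity). For a Hom-Lie algebra $(L,[-,-],\alpha)$, $Z(\alpha(L))$ denotes the subset of $L$ consisting of all elements $x \in L$ such that $[x,\alpha(y)] = 0$ for all $y \in L$. A Hom-Novikov algebra is a triple $(A,\mu,\alpha)$ where $A$ is a vector space, $\mu \colon A^{\otimes 2} \to A$ is a bilinear map (written $xy=\mu(x,y)$) and $\alpha \colon A \to A$ is a linear map, such that for all $x,y,z \in A$: (i) $\alpha(xy) = \alpha(x)\alpha(y)$; (ii) $(xy)\alpha(z) - \alpha(x)(yz) = (yx)\alpha(z) - \alpha(y)(xz)$; (iii) $(xy)\alpha(z) = (xz)\alpha(y)$. *)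

theory Defs
  imports Complex_Main
begin

text \<open>
  A vector space over the field \<open>'k\<close> is a type \<open>'a\<close> of class \<^class>\<open>ab_group_add\<close> with a scalar
  multiplication satisfying \<^locale>\<open>vector_space\<close>; the space is the whole type.
\<close>

definition bilinear_map ::
  "('k::field \<Rightarrow> 'a::ab_group_add \<Rightarrow> 'a) \<Rightarrow> ('a \<Rightarrow> 'a \<Rightarrow> 'a) \<Rightarrow> bool" where
  "bilinear_map scale m \<longleftrightarrow>
     (\<forall>x. Vector_Spaces.linear scale scale (\<lambda>y. m x y)) \<and>
     (\<forall>y. Vector_Spaces.linear scale scale (\<lambda>x. m x y))"

locale hom_lie_algebra = vector_space scale
  for scale :: "'k::field_char_0 \<Rightarrow> 'a::ab_group_add \<Rightarrow> 'a" +
  fixes bracket :: "'a \<Rightarrow> 'a \<Rightarrow> 'a"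
    and \<alpha> :: "'a \<Rightarrow> 'a"
  assumes linear_twist: "Vector_Spaces.linear scale scale \<alpha>"
    and bilinear_bracket: "bilinear_map scale bracket"
    and skew_symmetric: "bracket x y = - bracket y x"
    and multiplicative: "\<alpha> (bracket x y) = bracket (\<alpha> x) (\<alpha> y)"
    and hom_jacobi:
      "bracket (bracket x y) (\<alpha> z) + bracket (bracket z x) (\<alpha> y) + bracket (bracket y z) (\<alpha> x) = 0"

text \<open>The set \<open>Z(\<alpha>(L))\<close>: elements of all of \<open>L\<close>, not only of the image of \<open>\<alpha>\<close>.\<close>

definition Z_image :: "('a \<Rightarrow> 'a \<Rightarrow> 'a::ab_group_add) \<Rightarrow> ('a \<Rightarrow> 'a) \<Rightarrow> 'a set" where
  "Z_image bracket \<alpha> = {x. \<forall>y. bracket x (\<alpha> y) = 0}"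

locale hom_novikov_algebra = vector_space scale
  for scale :: "'k::field_char_0 \<Rightarrow> 'a::ab_group_add \<Rightarrow> 'a" +
  fixes mult :: "'a \<Rightarrow> 'a \<Rightarrow> 'a"
    and \<alpha> :: "'a \<Rightarrow> 'a"
  assumes linear_twist: "Vector_Spaces.linear scale scale \<alpha>"
    and bilinear_mult: "bilinear_map scale mult"
    and multiplicative: "\<alpha> (mult x y) = mult (\<alpha> x) (\<alpha> y)"
    and left_symmetric:
      "mult (mult x y) (\<alpha> z) - mult (\<alpha> x) (mult y z) =
       mult (mult y x) (\<alpha> z) - mult (\<alpha> y) (mult x z)"
    and right_commutative: "mult (mult x y) (\<alpha> z) = mult (mult x z) (\<alpha> y)"

end

theory Submission
  imports Defs
begin

text \<open>
  Left symmetry of \<open>x \<star> y = [f x, y]\<close> differs from the first condition of part (1) by the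
  Hom-Jacobi identity at \<open>(f x, f y, z)\<close>, and right commutativity of \<open>x \<star>' y = [x, f y]\<close>
  differs from the second condition of part (2) by the Hom-Jacobi identity at \<open>(x, f y, f z)\<close>.
  The other two conditions are the remaining identities up to skew-symmetry.
\<close>

text \<open>With the identity in one slot, this gives bilinearity of both twisted products.\<close>

lemma bilinear_map_comp:
  assumes "bilinear_map scale m"
    and f: "Vector_Spaces.linear scale scale f" and g: "Vector_Spaces.linear scale scale g"
  shows "bilinear_map scale (\<lambda>x y. m (f x) (g y))"
  using assms Vector_Spaces.linear_compose[OF f] Vector_Spaces.linear_compose[OF g]
  unfolding bilinear_map_def comp_def by blast

context hom_lie_algebra
begin

lemma bracket_add_left: "bracket (x + y) z = bracket x z + bracket y z"
proof -
  interpret Vector_Spaces.linear scale scale "\<lambda>x. bracket x z"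
    using bilinear_bracket unfolding bilinear_map_def by blast
  show ?thesis
    by (rule add)
qed

lemma bracket_minus_left: "bracket (- x) z = - bracket x z"
  \<comment> \<open>Additivity at \<open>0\<close> and \<open>0\<close> forces
    \<open>bracket 0 z = 0\<close>, so the brackets of \<open>x\<close> and \<open>- x\<close> with
    \<open>z\<close> cancel.\<close>
  using bracket_add_left[of x "- x" z] bracket_add_left[of 0 0 z]
  by (simp add: eq_neg_iff_add_eq_0 add.commute)

lemma bracket_diff_left: "bracket (x - y) z = bracket x z - bracket y z"
  using bracket_add_left[of x "- y" z] by (simp add: bracket_minus_left)

text \<open>Skew-symmetry brings Hom-Jacobi into Leibniz form: the nested brackets sit on the right,
  as in the terms of left symmetry that carry a twisted left factor.\<close>

lemma hom_jacobi_derivation: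
  "bracket (\<alpha> x) (bracket y z) - bracket (\<alpha> y) (bracket x z) = bracket (bracket x y) (\<alpha> z)"
proof -
  have "bracket (\<alpha> x) (bracket y z) = - bracket (bracket y z) (\<alpha> x)"
    by (rule skew_symmetric)
  moreover have "bracket (\<alpha> y) (bracket x z) = bracket (bracket z x) (\<alpha> y)"
    using skew_symmetric[of "\<alpha> y" "bracket x z"] skew_symmetric[of x z]
    by (simp add: bracket_minus_left)
  moreover have "bracket (bracket x y) (\<alpha> z) =
      - (bracket (bracket z x) (\<alpha> y) + bracket (bracket y z) (\<alpha> x))"
    using hom_jacobi[of x y z] by (simp only: eq_neg_iff_add_eq_0 add.assoc)
  ultimately show ?thesis
    by simp
qed

text \<open>Hom-Jacobi solved for the defect of right commutativity in the last two
  arguments.\<close>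

lemma hom_jacobi_commutator:
  "bracket (bracket x y) (\<alpha> z) - bracket (bracket x z) (\<alpha> y) = - bracket (bracket y z) (\<alpha> x)"
  using hom_jacobi[of x y z] skew_symmetric[of z x]
  by (simp add: bracket_minus_left algebra_simps eq_neg_iff_add_eq_0)

lemma hom_novikov_bracket_left_iff:
  assumes f: "Vector_Spaces.linear scale scale f" and comm: "f \<circ> \<alpha> = \<alpha> \<circ> f"
  shows "hom_novikov_algebra scale (\<lambda>x y. bracket (f x) y) \<alpha> \<longleftrightarrow>
    (\<forall>x y. f (bracket (f x) y + bracket x (f y)) - bracket (f x) (f y) \<in> Z_image bracket \<alpha>) \<and>
    (\<forall>x y z. bracket (f (bracket (f x) y)) (\<alpha> z) = bracket (f (bracket (f x) z)) (\<alpha> y))"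
    (is "?N \<longleftrightarrow> _")
proof -
  interpret f: Vector_Spaces.linear scale scale f by (fact f)
  have comm': "f (\<alpha> x) = \<alpha> (f x)" for x
    using comm by (metis comp_apply)
  have bilin: "bilinear_map scale (\<lambda>x y. bracket (f x) y)"
    using bilinear_map_comp[OF bilinear_bracket f linear_id] by (simp add: id_def)
  \<comment> \<open>The right-hand side is the defect of left symmetry. Skew-symmetry under
    \<open>f\<close> produces its term with \<open>x\<close> and \<open>y\<close> swapped, and the
    Leibniz form splits the bracket of \<open>bracket (f x) (f y)\<close> with
    \<open>\<alpha> z\<close> into its two nested terms.\<close>
  have "bracket (f (bracket (f x) y + bracket x (f y)) - bracket (f x) (f y)) (\<alpha> z) =
      (bracket (f (bracket (f x) y)) (\<alpha> z) - bracket (f (\<alpha> x)) (bracket (f y) z)) -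
      (bracket (f (bracket (f y) x)) (\<alpha> z) - bracket (f (\<alpha> y)) (bracket (f x) z))" for x y z
  proof -
    have "f (bracket x (f y)) = - f (bracket (f y) x)"
      by (subst skew_symmetric) (rule f.neg)
    then show ?thesis
      using hom_jacobi_derivation[of "f x" "f y" z, symmetric]
      by (simp add: comm' f.add bracket_add_left bracket_diff_left bracket_minus_left)
  qed
  then have key: "bracket (f (bracket (f x) y + bracket x (f y)) - bracket (f x) (f y)) (\<alpha> z) = 0 \<longleftrightarrow>
      bracket (f (bracket (f x) y)) (\<alpha> z) - bracket (f (\<alpha> x)) (bracket (f y) z) =
      bracket (f (bracket (f y) x)) (\<alpha> z) - bracket (f (\<alpha> y)) (bracket (f x) z)" for x y z
    by simp
  \<comment> \<open>Only left symmetry and right commutativity remain: multiplicativity of the new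
    product follows from that of the bracket because \<open>f\<close> commutes with
    \<open>\<alpha>\<close>.\<close>
  have "?N \<longleftrightarrow> (\<forall>x y z.
      bracket (f (bracket (f x) y)) (\<alpha> z) - bracket (f (\<alpha> x)) (bracket (f y) z) =
      bracket (f (bracket (f y) x)) (\<alpha> z) - bracket (f (\<alpha> y)) (bracket (f x) z)) \<and>
    (\<forall>x y z. bracket (f (bracket (f x) y)) (\<alpha> z) = bracket (f (bracket (f x) z)) (\<alpha> y))"
    unfolding hom_novikov_algebra_def hom_novikov_algebra_axioms_def
    using bilin linear_twist multiplicative vector_space_axioms by (simp add: comm')
  then show ?thesis
    unfolding Z_image_def mem_Collect_eq key .
qed

lemma hom_novikov_bracket_right_iff:
  assumes f: "Vector_Spaces.linear scale scale f" and comm: "f \<circ> \<alpha> = \<alpha> \<circ> f"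
  shows "hom_novikov_algebra scale (\<lambda>x y. bracket x (f y)) \<alpha> \<longleftrightarrow>
    (\<forall>x y z. bracket (bracket x (f y) + bracket (f x) y) (f (\<alpha> z))
              - bracket (\<alpha> x) (f (bracket y (f z)))
              + bracket (\<alpha> y) (f (bracket x (f z))) = 0) \<and>
    (\<forall>x y. bracket (f x) (f y) \<in> Z_image bracket \<alpha>)"
    (is "?N \<longleftrightarrow> _")
proof -
  have comm': "f (\<alpha> x) = \<alpha> (f x)" for x
    using comm by (metis comp_apply)
  have bilin: "bilinear_map scale (\<lambda>x y. bracket x (f y))"
    using bilinear_map_comp[OF bilinear_bracket linear_id f] by (simp add: id_def)
  \<comment> \<open>Here skew-symmetry alone suffices: one sign change moves all terms of left
    symmetry to one side.\<close>
  have left: "bracket (bracket x (f y) + bracket (f x) y) (f (\<alpha> z))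
      - bracket (\<alpha> x) (f (bracket y (f z))) + bracket (\<alpha> y) (f (bracket x (f z))) = 0 \<longleftrightarrow>
    bracket (bracket x (f y)) (f (\<alpha> z)) - bracket (\<alpha> x) (f (bracket y (f z))) =
    bracket (bracket y (f x)) (f (\<alpha> z)) - bracket (\<alpha> y) (f (bracket x (f z)))" for x y z
  proof -
    have "bracket (bracket y (f x)) (f (\<alpha> z)) = - bracket (bracket (f x) y) (f (\<alpha> z))"
      by (subst skew_symmetric[of y]) (rule bracket_minus_left)
    then show ?thesis
      by (simp add: bracket_add_left algebra_simps)
  qed
  \<comment> \<open>The first factor \<open>x\<close> of right commutativity becomes the element
    tested against \<open>bracket (f y) (f z)\<close>, so the quantified variables must be reordered
    at the end.\<close>
  have right: "bracket (bracket (f y) (f z)) (\<alpha> x) = 0 \<longleftrightarrow>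
      bracket (bracket x (f y)) (f (\<alpha> z)) = bracket (bracket x (f z)) (f (\<alpha> y))" for x y z
    using hom_jacobi_commutator[of x "f y" "f z"]
    \<comment> \<open>Fixing the left side turns only the commutativity equation into a vanishing
      difference; the unrestricted rule would apply to its own result.\<close>
    by (simp add: comm' flip: right_minus_eq[of "bracket (bracket x (f y)) _"])
  have "?N \<longleftrightarrow> (\<forall>x y z.
      bracket (bracket x (f y)) (f (\<alpha> z)) - bracket (\<alpha> x) (f (bracket y (f z))) =
      bracket (bracket y (f x)) (f (\<alpha> z)) - bracket (\<alpha> y) (f (bracket x (f z)))) \<and>
    (\<forall>x y z. bracket (bracket x (f y)) (f (\<alpha> z)) = bracket (bracket x (f z)) (f (\<alpha> y)))"
    unfolding hom_novikov_algebra_def hom_novikov_algebra_axioms_def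
    using bilin linear_twist multiplicative vector_space_axioms by (simp add: comm')
  then show ?thesis
    unfolding Z_image_def mem_Collect_eq left right by blast
qed

end

theorem theorem1p4:
  fixes scale :: "'k::field_char_0 \<Rightarrow> 'a::ab_group_add \<Rightarrow> 'a"
    and bracket :: "'a \<Rightarrow> 'a \<Rightarrow> 'a"
    and \<alpha> f :: "'a \<Rightarrow> 'a"
  assumes "hom_lie_algebra scale bracket \<alpha>"
    and "Vector_Spaces.linear scale scale f"
    and "f \<circ> \<alpha> = \<alpha> \<circ> f"
  shows
    "(hom_novikov_algebra scale (\<lambda>x y. bracket (f x) y) \<alpha> \<longleftrightarrow>
       (\<forall>x y. f (bracket (f x) y + bracket x (f y)) - bracket (f x) (f y) \<in> Z_image bracket \<alpha>) \<and>
       (\<forall>x y z. bracket (f (bracket (f x) y)) (\<alpha> z) = bracket (f (bracket (f x) z)) (\<alpha> y)))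
     \<and>
     (hom_novikov_algebra scale (\<lambda>x y. bracket x (f y)) \<alpha> \<longleftrightarrow>
       (\<forall>x y z. bracket (bracket x (f y) + bracket (f x) y) (f (\<alpha> z))
                 - bracket (\<alpha> x) (f (bracket y (f z)))
                 + bracket (\<alpha> y) (f (bracket x (f z))) = 0) \<and>
       (\<forall>x y. bracket (f x) (f y) \<in> Z_image bracket \<alpha>))"
  using hom_lie_algebra.hom_novikov_bracket_left_iff[OF assms]
    hom_lie_algebra.hom_novikov_bracket_right_iff[OF assms]
  by blast

end
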